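(* Let $\varrho$ be a three qubit state with X-part $X(a,b,c)$, and let $\{i_1,i_2\}\cup\{i_3,i_4\}=\{1,2,3,4\}$ be a partition. Put $m_1=\frac{|c_{i_1}|+|c_{i_2}|}{2}$ and $m_2=\frac{|c_{i_3}|+|c_{i_4}|}{2}$, and assume $(m_1,m_2)\neq(0,0)$. If $\varrho$ is separable, then $$\Delta_\varrho\ \ge\ \frac{\sqrt2\,m_1m_2}{\sqrt{m_1^2+m_2^2}}\sqrt{1+|\sin(\phi_c/2)|}.$$
   Context: For $a,b\in\mathbb R^4$ and $c\in\mathbb C^4$, $X(a,b,c)$ denotes the $8\times 8$ self-adjoint matrix, regarded as an element of $M_2\otimes M_2\otimes M_2$ (complex $2\times 2$ matrices, basis indices $000,001,\dots,111$ in lexicographic order), whose diagonal is $(a_1,a_2,a_3,a_4,b_4,b_3,b_2,b_1)$, whose anti-diagonal entries, read from the top-right corner to the bottom-left corner, are $(c_1,c_2,c_3,c_4,\bar c_4,\bar c_3,\bar c_2,\bar c_1)$, and all of whose other entries are zero. A three qubit state is a positive semidefinite matrix in $M_2\otimes M_2\otimes M_2$ (normalization disregarded). The X-part of an $8\times8$ matrix is obtained by replacing by zero all entries that are neither diagonal nor anti-diagonal. A state is separable if it is a sum of pure product states, i.e. of rank one projections, up to positive scalars, onto product vectors $x\otimes y\otimes w$ with $x,y,w\in\mathbb C^2$. For a state $\varrho$ with X-part $X(a,b,c)$, $$\Delta_\varrho=\min\{\sqrt{a_1b_1},\sqrt{a_2b_2},\sqrt{a_3b_3},\sqrt{a_4b_4},\sqrt[4]{a_1b_2b_3a_4},\sqrt[4]{b_1a_2a_3b_4}\}.$$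 Writing $c_j=|c_j|e^{\mathrm i\theta_j}$, the phase difference is $\phi_c=(\theta_1+\theta_4)-(\theta_2+\theta_3)$ mod $2\pi$ (if some $c_j=0$, any $\theta_j$ may be chosen). *)

theory Defs
  imports "HOL-Analysis.Analysis" "HOL-Library.Real_Mod"
begin

text \<open>Vectors of the threefold tensor power of the qubit space and elements of the threefold
  tensor power of the algebra of complex 2 by 2 matrices are indexed by triples of bits.  The bits
  are the two elements \<open>0\<close> and \<open>1\<close> of the numeral type \<open>2\<close>; the first index of a
  matrix is the row.  In the numeral types \<open>2\<close> and \<open>4\<close> arithmetic is modular, so the
  component index \<open>4 :: 4\<close> is the same element as \<open>0\<close>.\<close>

type_synonym qubit = "complex ^ 2"
type_synonym three_qubit_vec = "complex ^ (2 \<times> 2 \<times> 2)"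
type_synonym three_qubit_mat = "complex ^ (2 \<times> 2 \<times> 2) ^ (2 \<times> 2 \<times> 2)"

definition bit_val :: "2 \<Rightarrow> nat" where
  "bit_val p = (if p = 0 then 0 else 1)"

text \<open>The position, between 0 and 7, of an index triple in the lexicographic order.\<close>

definition lex_pos :: "2 \<times> 2 \<times> 2 \<Rightarrow> nat" where
  "lex_pos = (\<lambda>(p, q, r). 4 * bit_val p + 2 * bit_val q + bit_val r)"

definition X_mat :: "real ^ 4 \<Rightarrow> real ^ 4 \<Rightarrow> complex ^ 4 \<Rightarrow> three_qubit_mat" where
  "X_mat a b c = (\<chi> i j.
     if lex_pos i = lex_pos j then
       complex_of_real ([a$1, a$2, a$3, a$4, b$4, b$3, b$2, b$1] ! lex_pos i)
     else if lex_pos i + lex_pos j = 7 then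
       [c$1, c$2, c$3, c$4, cnj (c$4), cnj (c$3), cnj (c$2), cnj (c$1)] ! lex_pos i
     else 0)"

definition X_part :: "three_qubit_mat \<Rightarrow> three_qubit_mat" where
  "X_part A = (\<chi> i j.
     if lex_pos i = lex_pos j \<or> lex_pos i + lex_pos j = 7 then A $ i $ j else 0)"

definition self_adjoint :: "complex ^ 'n ^ 'n \<Rightarrow> bool" where
  "self_adjoint A \<longleftrightarrow> (\<forall>i j. A $ i $ j = cnj (A $ j $ i))"

text \<open>For a self-adjoint matrix the quadratic form is real, so that taking the real part
  loses nothing.\<close>

definition positive_semidefinite :: "complex ^ 'n ^ 'n \<Rightarrow> bool" where
  "positive_semidefinite A \<longleftrightarrow>
     self_adjoint A \<and> (\<forall>v. 0 \<le> Re (\<Sum>i\<in>UNIV. cnj (v $ i) * (A *v v) $ i))"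

definition three_qubit_state :: "three_qubit_mat \<Rightarrow> bool" where
  "three_qubit_state \<rho> \<longleftrightarrow> positive_semidefinite \<rho>"

definition product_vec :: "qubit \<Rightarrow> qubit \<Rightarrow> qubit \<Rightarrow> three_qubit_vec" where
  "product_vec x y w = (\<chi> i. case i of (p, q, r) \<Rightarrow> x $ p * y $ q * w $ r)"

text \<open>The orthogonal projection onto the line spanned by \<open>z\<close>, for \<open>z \<noteq> 0\<close>.\<close>

definition rank_one_projection :: "complex ^ 'n \<Rightarrow> complex ^ 'n ^ 'n" where
  "rank_one_projection z = (\<chi> i j. z $ i * cnj (z $ j) / complex_of_real ((norm z)\<^sup>2))"

definition pure_product_state :: "three_qubit_mat \<Rightarrow> bool" where
  "pure_product_state P \<longleftrightarrow>
     (\<exists>t x y w. t > 0 \<and> product_vec x y w \<noteq> 0 \<and>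
        P = t *\<^sub>R rank_one_projection (product_vec x y w))"

definition separable :: "three_qubit_mat \<Rightarrow> bool" where
  "separable \<rho> \<longleftrightarrow>
     (\<exists>(n::nat) P. (\<forall>k<n. pure_product_state (P k)) \<and> \<rho> = (\<Sum>k<n. P k))"

definition Delta :: "real ^ 4 \<Rightarrow> real ^ 4 \<Rightarrow> real" where
  "Delta a b = Min {sqrt (a$1 * b$1), sqrt (a$2 * b$2), sqrt (a$3 * b$3), sqrt (a$4 * b$4),
     root 4 (a$1 * b$2 * b$3 * a$4), root 4 (b$1 * a$2 * a$3 * b$4)}"

text \<open>A relation between \<open>c\<close> and a real \<open>\<phi>\<close>, because the phase difference is
  only determined modulo \<open>2 * pi\<close>, and is arbitrary if some entry of \<open>c\<close> vanishes.\<close>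

definition phase_difference :: "complex ^ 4 \<Rightarrow> real \<Rightarrow> bool" where
  "phase_difference c \<phi> \<longleftrightarrow>
     (\<exists>\<theta> :: real ^ 4. (\<forall>j. c $ j = rcis (cmod (c $ j)) (\<theta> $ j)) \<and>
        [\<phi> = (\<theta>$1 + \<theta>$4) - (\<theta>$2 + \<theta>$3)] (rmod (2 * pi)))"

end

theory Submission
  imports Defs
begin

text \<open>For a product vector the four anti-diagonal entries \<open>d\<^sub>j\<close> of the projection have a common
  modulus \<open>r\<close> and satisfy \<open>d\<^sub>1 d\<^sub>4 = d\<^sub>2 d\<^sub>3\<close>, and \<open>r\<close> is also the value of each of the six terms
  in \<open>Delta\<close>.  Cauchy-Schwarz makes these terms superadditive, so \<open>Delta a b\<close> is at least the
  sum \<open>R\<close> of the moduli over a decomposition of \<open>\<rho>\<close>.  To bound \<open>R\<close> from below by \<open>c\<close>, pair \<open>c\<close>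
  with \<open>s\<^sub>j e\<^sub>j\<close>, where \<open>s\<^sub>j\<close> is \<open>m1\<close> or \<open>m2\<close> according to the partition and the phases of the
  unimodular \<open>e\<^sub>j\<close> deviate from those of \<open>cnj (c\<^sub>j)\<close> by an angle \<open>\<plusminus>\<delta>\<close>, chosen so that
  \<open>e\<^sub>1 e\<^sub>4 = - e\<^sub>2 e\<^sub>3\<close>.  The last relation makes the cross terms cancel in the estimate of the
  pairing with a product vector, whereas the pairing with \<open>c\<close> only loses the factor
  \<open>\<bar>cos \<delta>\<bar> = sqrt ((1 + \<bar>sin (\<phi> / 2)\<bar>) / 2)\<close>.  This gives
  \<open>R \<ge> sqrt (m1\<^sup>2 + m2\<^sup>2) * \<bar>cos \<delta>\<bar>\<close>, which is stronger than the claim by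
  \<open>2 * m1 * m2 \<le> m1\<^sup>2 + m2\<^sup>2\<close>.\<close>

section \<open>Superadditivity of geometric means\<close>

lemma sum_le_sqrt_sum_mult:
  fixes f \<alpha> \<beta> :: "'a \<Rightarrow> real"
  assumes "\<And>k. k \<in> A \<Longrightarrow> 0 \<le> \<alpha> k" "\<And>k. k \<in> A \<Longrightarrow> 0 \<le> \<beta> k"
    and "\<And>k. k \<in> A \<Longrightarrow> 0 \<le> f k" "\<And>k. k \<in> A \<Longrightarrow> (f k)\<^sup>2 = \<alpha> k * \<beta> k"
  shows "sum f A \<le> sqrt (sum \<alpha> A * sum \<beta> A)"
proof -
  have "f k = sqrt (\<alpha> k) * sqrt (\<beta> k)" if "k \<in> A" for k
    using assms that by (metis real_sqrt_mult real_sqrt_unique)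
  then have "sum f A = (\<Sum>k\<in>A. sqrt (\<alpha> k) * sqrt (\<beta> k))"
    by (rule sum.cong[OF refl])
  also have "\<dots>\<^sup>2 \<le> (\<Sum>k\<in>A. (sqrt (\<alpha> k))\<^sup>2) * (\<Sum>k\<in>A. (sqrt (\<beta> k))\<^sup>2)"
    by (rule Cauchy_Schwarz_ineq_sum)
  also have "\<dots> = sum \<alpha> A * sum \<beta> A"
    using assms by simp
  finally show ?thesis
    by (rule real_le_rsqrt)
qed

text \<open>A fourth root of four factors is a geometric mean of two geometric means, so the square
  root case applies once outside and twice inside.\<close>

lemma sum_le_root_4_sum_mult:
  fixes f \<alpha> \<beta> \<gamma> \<delta> :: "'a \<Rightarrow> real"
  assumes "\<And>k. k \<in> A \<Longrightarrow> 0 \<le> \<alpha> k" "\<And>k. k \<in> A \<Longrightarrow> 0 \<le> \<beta> k"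
    and "\<And>k. k \<in> A \<Longrightarrow> 0 \<le> \<gamma> k" "\<And>k. k \<in> A \<Longrightarrow> 0 \<le> \<delta> k"
    and "\<And>k. k \<in> A \<Longrightarrow> 0 \<le> f k" "\<And>k. k \<in> A \<Longrightarrow> (f k) ^ 4 = \<alpha> k * \<beta> k * \<gamma> k * \<delta> k"
  shows "sum f A \<le> root 4 (sum \<alpha> A * sum \<beta> A * sum \<gamma> A * sum \<delta> A)"
proof -
  let ?g = "\<lambda>k. sqrt (\<alpha> k * \<beta> k)" and ?h = "\<lambda>k. sqrt (\<gamma> k * \<delta> k)"
  have "(f k)\<^sup>2 = ?g k * ?h k" if "k \<in> A" for k
  proof (rule real_sqrt_unique[symmetric, THEN trans])
    show "((f k)\<^sup>2)\<^sup>2 = \<alpha> k * \<beta> k * (\<gamma> k * \<delta> k)"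
      using assms(6)[OF that] by (simp add: mult.assoc flip: power_mult)
  qed (simp_all add: real_sqrt_mult)
  then have fgh: "sum f A \<le> sqrt (sum ?g A * sum ?h A)"
    using assms by (intro sum_le_sqrt_sum_mult) simp_all
  have g: "sum ?g A \<le> sqrt (sum \<alpha> A * sum \<beta> A)" and h: "sum ?h A \<le> sqrt (sum \<gamma> A * sum \<delta> A)"
    using assms by (auto intro!: sum_le_sqrt_sum_mult)
  have "sum ?g A * sum ?h A \<le> sqrt (sum \<alpha> A * sum \<beta> A) * sqrt (sum \<gamma> A * sum \<delta> A)"
    using assms by (intro mult_mono[OF g h]) (auto intro!: sum_nonneg mult_nonneg_nonneg)
  also have "\<dots> = sqrt (sum \<alpha> A * sum \<beta> A * sum \<gamma> A * sum \<delta> A)"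
    by (simp add: real_sqrt_mult mult.assoc)
  finally have "sqrt (sum ?g A * sum ?h A) \<le> sqrt (sqrt (sum \<alpha> A * sum \<beta> A * sum \<gamma> A * sum \<delta> A))"
    by (rule real_sqrt_le_mono)
  with fgh have "sum f A \<le> sqrt (sqrt (sum \<alpha> A * sum \<beta> A * sum \<gamma> A * sum \<delta> A))"
    by (rule order_trans)
  also have "\<dots> = root 4 (sum \<alpha> A * sum \<beta> A * sum \<gamma> A * sum \<delta> A)"
    using real_root_mult_exp[of 2 2] by (simp add: sqrt_def)
  finally show ?thesis .
qed

section \<open>Entries of X-parts and of separable states\<close>

text \<open>The \<open>j\<close>-th triple in lexicographic order; \<open>lower j\<close> is its
  bitwise complement. In an X-matrix \<open>a $ j\<close> and \<open>b $ j\<close> sit on the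
  diagonal at these two triples, and \<open>c $ j\<close> in row \<open>upper j\<close> and column
  \<open>lower j\<close>.\<close>

definition upper :: "4 \<Rightarrow> 2 \<times> 2 \<times> 2" where
  "upper j = (0, if j = 3 \<or> j = 4 then 1 else 0, if j = 2 \<or> j = 4 then 1 else 0)"

definition lower :: "4 \<Rightarrow> 2 \<times> 2 \<times> 2" where
  "lower j = (1, if j = 3 \<or> j = 4 then 0 else 1, if j = 2 \<or> j = 4 then 0 else 1)"

lemma X_part_eq_X_matD:
  assumes "X_part A = X_mat a b c"
  shows "complex_of_real (a $ j) = A $ upper j $ upper j"
    and "complex_of_real (b $ j) = A $ lower j $ lower j"
    and "c $ j = A $ upper j $ lower j"
proof -
  have "X_part A $ p $ q = X_mat a b c $ p $ q" for p q
    using assms by simp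
  from this[of "upper j" "upper j"] this[of "lower j" "lower j"] this[of "upper j" "lower j"]
  show "complex_of_real (a $ j) = A $ upper j $ upper j"
    and "complex_of_real (b $ j) = A $ lower j $ lower j"
    and "c $ j = A $ upper j $ lower j"
    using exhaust_4[of j]
    by (auto simp: X_part_def X_mat_def upper_def lower_def lex_pos_def bit_val_def)
qed

lemma separable_entries:
  assumes "separable \<rho>"
  shows "\<exists>(n::nat) l x y w. (\<forall>k. 0 \<le> l k) \<and> (\<forall>i j. \<rho> $ i $ j =
    (\<Sum>k<n. complex_of_real (l k) *
      (product_vec (x k) (y k) (w k) $ i * cnj (product_vec (x k) (y k) (w k) $ j))))"
proof -
  obtain n :: nat and P where P: "\<forall>k<n. pure_product_state (P k)" and \<rho>: "\<rho> = (\<Sum>k<n. P k)"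
    using assms by (auto simp: separable_def)
  have "\<forall>k. \<exists>t x y w. k < n \<longrightarrow>
      t > 0 \<and> P k = t *\<^sub>R rank_one_projection (product_vec x y w)"
    using P by (fastforce simp: pure_product_state_def)
  then obtain t x y w where t: "\<And>k. k < n \<Longrightarrow> t k > 0"
    and Pk: "\<And>k. k < n \<Longrightarrow> P k = t k *\<^sub>R rank_one_projection (product_vec (x k) (y k) (w k))"
    by metis
  \<comment> \<open>The normalization of each projection moves into its weight. Nothing is known
    about \<open>t k\<close> unless \<open>k < n\<close>; the absolute value makes every weight
    nonnegative.\<close>
  show ?thesis
  proof (rule exI[of _ n], rule exI[of _ "\<lambda>k. \<bar>t k\<bar> / (norm (product_vec (x k) (y k) (w k)))\<^sup>2"],
      rule exI[of _ x], rule exI[of _ y], rule exI[of _ w], intro conjI allI)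
    fix i j
    have "\<rho> $ i $ j = (\<Sum>k<n. P k $ i $ j)"
      by (simp add: \<rho>)
    also have "\<dots> = (\<Sum>k<n.
        complex_of_real (\<bar>t k\<bar> / (norm (product_vec (x k) (y k) (w k)))\<^sup>2) *
        (product_vec (x k) (y k) (w k) $ i * cnj (product_vec (x k) (y k) (w k) $ j)))"
      using t by (intro sum.cong)
        (simp_all add: Pk rank_one_projection_def scaleR_conv_of_real[where ?'a = complex] abs_of_pos)
    finally show "\<rho> $ i $ j = \<dots>" .
  qed simp
qed

section \<open>Moduli of product vectors and the lower bound for \<open>Delta\<close>\<close>

definition coherence :: "qubit \<Rightarrow> qubit \<Rightarrow> qubit \<Rightarrow> real" where
  "coherence x y w = cmod (x $ 0 * x $ 1) * cmod (y $ 0 * y $ 1) * cmod (w $ 0 * w $ 1)"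

lemma coherence_nonneg: "0 \<le> coherence x y w"
  by (simp add: coherence_def)

text \<open>Complementary triples use both components of each tensor factor exactly once, whatever
  \<open>j\<close> is.\<close>

lemma norm_product_vec_upper_lower:
  "cmod (product_vec x y w $ upper j * cnj (product_vec x y w $ lower j)) = coherence x y w"
  using exhaust_4[of j]
  by (auto simp: product_vec_def upper_def lower_def coherence_def norm_mult)

text \<open>Either product is the square of \<open>x $ 0 * cnj (x $ 1)\<close> times the squared
  moduli of all components of \<open>y\<close> and \<open>w\<close>.\<close>

lemma product_vec_phase_identity:
  fixes x y w
  defines "d \<equiv> \<lambda>j. product_vec x y w $ upper j * cnj (product_vec x y w $ lower j)"
  shows "d 1 * d 4 = d 2 * d 3"
  by (simp add: d_def product_vec_def upper_def lower_def)

text \<open>Each product runs over the four triples of one parity, among which every tensor position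
  takes each bit twice.\<close>

lemma norm_product_vec_mult_4:
  "cmod (product_vec x y w $ upper 1) * cmod (product_vec x y w $ lower 2) *
    cmod (product_vec x y w $ lower 3) * cmod (product_vec x y w $ upper 4) = (coherence x y w)\<^sup>2"
  "cmod (product_vec x y w $ lower 1) * cmod (product_vec x y w $ upper 2) *
    cmod (product_vec x y w $ upper 3) * cmod (product_vec x y w $ lower 4) = (coherence x y w)\<^sup>2"
  by (simp_all add: product_vec_def upper_def lower_def coherence_def norm_mult power2_eq_square)

lemma Delta_ge_sum_coherence:
  fixes l :: "nat \<Rightarrow> real"
  defines "z \<equiv> \<lambda>x y w k. product_vec (x k) (y k) (w k)"
  assumes l: "\<And>k. 0 \<le> l k"
    and a: "\<And>j. a $ j = (\<Sum>k<n. l k * (cmod (z x y w k $ upper j))\<^sup>2)"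
    and b: "\<And>j. b $ j = (\<Sum>k<n. l k * (cmod (z x y w k $ lower j))\<^sup>2)"
  shows "(\<Sum>k<n. l k * coherence (x k) (y k) (w k)) \<le> Delta a b"
proof -
  let ?R = "\<Sum>k<n. l k * coherence (x k) (y k) (w k)"
  have 2: "?R \<le> sqrt (a $ j * b $ j)" for j
    unfolding a b
  proof (rule sum_le_sqrt_sum_mult)
    fix k
    show "(l k * coherence (x k) (y k) (w k))\<^sup>2 =
        l k * (cmod (z x y w k $ upper j))\<^sup>2 * (l k * (cmod (z x y w k $ lower j))\<^sup>2)"
      unfolding norm_product_vec_upper_lower[of "x k" "y k" "w k" j, symmetric] z_def
      by (simp add: norm_mult power2_eq_square)
  qed (use l in \<open>simp_all add: coherence_nonneg\<close>)
  have pow4: "(l * r) ^ 4 = l * p\<^sup>2 * (l * q\<^sup>2) * (l * s\<^sup>2) * (l * t\<^sup>2)"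
    if "p * q * s * t = r\<^sup>2" for l p q r s t :: real
  proof -
    have "(l * r) ^ 4 = l ^ 4 * (r\<^sup>2)\<^sup>2"
      by (simp add: power_mult_distrib flip: power_mult)
    then show ?thesis
      by (simp add: that[symmetric] power_mult_distrib power4_eq_xxxx)
  qed
  have 3: "?R \<le> root 4 (a $ 1 * b $ 2 * b $ 3 * a $ 4)"
    unfolding a b
    by (rule sum_le_root_4_sum_mult)
      (use l in \<open>simp_all add: coherence_nonneg z_def pow4 norm_product_vec_mult_4\<close>)
  have 4: "?R \<le> root 4 (b $ 1 * a $ 2 * a $ 3 * b $ 4)"
    unfolding a b
    by (rule sum_le_root_4_sum_mult)
      (use l in \<open>simp_all add: coherence_nonneg z_def pow4 norm_product_vec_mult_4\<close>)
  show ?thesis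
    using 2 3 4 by (simp add: Delta_def)
qed

section \<open>The pairing estimate for one product vector\<close>

text \<open>Cauchy-Schwarz for \<open>(p, q)\<close> and \<open>(A, B)\<close>. It serves where
  \<open>A\<close> and \<open>B\<close> depend on phases but the sum of their squares does
  not.\<close>

lemma add_le_sqrt_mult:
  fixes p q A B K r :: real
  assumes "A\<^sup>2 + B\<^sup>2 = K * r\<^sup>2" "0 \<le> r"
  shows "p * A + q * B \<le> r * sqrt (K * (p\<^sup>2 + q\<^sup>2))"
proof -
  have "(p * A + q * B)\<^sup>2 \<le> (p\<^sup>2 + q\<^sup>2) * (A\<^sup>2 + B\<^sup>2)"
    using zero_le_power2[of "p * B - q * A"] by (simp add: power2_eq_square algebra_simps)
  also have "\<dots> = r\<^sup>2 * (K * (p\<^sup>2 + q\<^sup>2))"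
    using assms by simp
  finally have "p * A + q * B \<le> sqrt (r\<^sup>2 * (K * (p\<^sup>2 + q\<^sup>2)))"
    by (rule real_le_rsqrt)
  then show ?thesis
    using assms(2) by (simp add: real_sqrt_mult)
qed

text \<open>Since real parts are unchanged by conjugating \<open>v 4\<close> and \<open>v 3\<close>, the cross terms of the squared
  norms below are \<open>Re (v 1 * v 4)\<close> and \<open>Re (v 2 * v 3)\<close>, which cancel.\<close>

lemma Re_weighted_sum_le:
  fixes v :: "4 \<Rightarrow> complex" and s :: "4 \<Rightarrow> real"
  assumes v: "\<And>j. cmod (v j) = r" and anti: "v 1 * v 4 = - (v 2 * v 3)"
    and s: "s 1 = s 4 \<and> s 2 = s 3 \<or> s 1 = s 2 \<and> s 3 = s 4 \<or> s 1 = s 3 \<and> s 2 = s 4"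
    and nonneg: "\<And>j. 0 \<le> s j"
  shows "(\<Sum>j\<in>UNIV. s j * Re (v j)) \<le> r * sqrt (2 * (\<Sum>j\<in>UNIV. (s j)\<^sup>2))"
proof -
  have r: "0 \<le> r"
    using v[of 1] norm_ge_zero by metis
  have norm_sq: "(cmod (of_real p * v i + of_real q * cnj (v j)))\<^sup>2
      = (p\<^sup>2 + q\<^sup>2) * r\<^sup>2 + 2 * p * q * Re (v i * v j)" for p q i j
  proof -
    have "(Re (v k))\<^sup>2 + (Im (v k))\<^sup>2 = r\<^sup>2" for k
      using v[of k] cmod_power2[of "v k"] by simp
    from this[of i] this[of j] show ?thesis
      by (simp add: cmod_power2) algebra
  qed
  have Re_le: "p * Re (v i) + q * Re (v j) \<le> cmod (of_real p * v i + of_real q * cnj (v j))"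
    for p q i j
    using complex_Re_le_cmod[of "of_real p * v i + of_real q * cnj (v j)"] by simp
  have Re_anti: "Re (v 1 * v 4) = - Re (v 2 * v 3)"
    using anti by simp
  \<comment> \<open>The relation \<open>anti\<close> pairs 1 with 4 and 2 with 3. Weights constant
    on these pairs are pulled out of the norms, so that the cross terms carry unit weights. In the
    other two arrangements the weights stay inside, and the cross terms cancel because
    \<open>s 1 * s 4 = s 2 * s 3\<close>.\<close>
  show ?thesis
  proof (cases "s 1 = s 4 \<and> s 2 = s 3")
    case True
    let ?A = "cmod (of_real 1 * v 1 + of_real 1 * cnj (v 4))"
      and ?B = "cmod (of_real 1 * v 2 + of_real 1 * cnj (v 3))"
    have "(\<Sum>j\<in>UNIV. s j * Re (v j))
        = s 1 * (1 * Re (v 1) + 1 * Re (v 4)) + s 2 * (1 * Re (v 2) + 1 * Re (v 3))"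
      using True by (simp add: sum_4 algebra_simps)
    also have "\<dots> \<le> s 1 * ?A + s 2 * ?B"
      by (intro add_mono mult_left_mono Re_le nonneg)
    also have "\<dots> \<le> r * sqrt (4 * ((s 1)\<^sup>2 + (s 2)\<^sup>2))"
      by (rule add_le_sqrt_mult) (use Re_anti r in \<open>simp_all only: norm_sq\<close>, simp)
    finally show ?thesis
      using True by (simp add: sum_4 algebra_simps)
  next
    case False
    let ?A = "cmod (of_real (s 1) * v 1 + of_real (s 4) * cnj (v 4))"
      and ?B = "cmod (of_real (s 2) * v 2 + of_real (s 3) * cnj (v 3))"
    have prod: "s 1 * s 4 = s 2 * s 3"
      using s False by auto
    have "?A\<^sup>2 + ?B\<^sup>2 = (\<Sum>j\<in>UNIV. (s j)\<^sup>2) * r\<^sup>2 + 2 * (s 1 * s 4 - s 2 * s 3) * Re (v 1 * v 4)"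
      unfolding norm_sq sum_4 Re_anti by (simp add: algebra_simps)
    then have "?A\<^sup>2 + ?B\<^sup>2 = (\<Sum>j\<in>UNIV. (s j)\<^sup>2) * r\<^sup>2"
      by (simp add: prod)
    from add_le_sqrt_mult[OF this r, of 1 1] have "?A + ?B \<le> r * sqrt (2 * (\<Sum>j\<in>UNIV. (s j)\<^sup>2))"
      by (simp add: mult.commute)
    then show ?thesis
      using Re_le[of "s 1" 1 "s 4" 4] Re_le[of "s 2" 2 "s 3" 3] by (simp add: sum_4)
  qed
qed

section \<open>Choice of the test phases\<close>

lemma phase_difference_antiphase:
  assumes "phase_difference c \<phi>"
  obtains e :: "4 \<Rightarrow> complex"
  where "\<And>j. cmod (e j) = 1" "e 1 * e 4 = - (e 2 * e 3)"
    and "\<And>j. Re (e j * c $ j) = cmod (c $ j) * sqrt ((1 + \<bar>sin (\<phi> / 2)\<bar>) / 2)"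
proof -
  obtain \<theta> :: "real ^ 4" where c: "\<And>j. c $ j = rcis (cmod (c $ j)) (\<theta> $ j)"
    and "[\<phi> = (\<theta>$1 + \<theta>$4) - (\<theta>$2 + \<theta>$3)] (rmod (2 * pi))"
    using assms by (auto simp: phase_difference_def)
  then obtain m :: int where "(\<theta>$1 + \<theta>$4) - (\<theta>$2 + \<theta>$3) = \<phi> + of_int m * (2 * pi)"
    by (auto simp: rcong_altdef)
  then have \<phi>: "\<theta>$1 + \<theta>$4 = \<theta>$2 + \<theta>$3 + \<phi> + of_int m * (2 * pi)"
    by simp
  \<comment> \<open>The quotient of \<open>e 2 * e 3\<close> by \<open>e 1 * e 4\<close> has phase
    \<phi> + 4 \<delta> modulo 2 pi, which has to be an odd multiple of pi. The values pi and - pi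
    give cos (2 \<delta>) opposite signs; the nonnegative one is taken, so that the loss factor is
    larger.\<close>
  define \<delta> where "\<delta> = (if sin (\<phi> / 2) \<ge> 0 then (pi - \<phi>) / 4 else (- pi - \<phi>) / 4)"
  \<comment> \<open>As \<phi> is an arbitrary representative, cos \<delta> may be negative. The sign
    \<sigma> corrects this and enters both products of the \<open>e j\<close> as a square.\<close>
  define \<sigma> :: complex where "\<sigma> = of_real (if cos \<delta> \<ge> 0 then 1 else -1)"
  define e where "e j = \<sigma> * cis (- (\<theta> $ j + (if j = 1 \<or> j = 4 then \<delta> else - \<delta>)))" for j
  have "\<phi> + 4 * \<delta> = pi \<or> \<phi> + 4 * \<delta> = - pi"
    by (simp add: \<delta>_def field_simps)
  then have cis_\<delta>: "cis (\<phi> + 4 * \<delta>) = -1"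
    by (auto simp: complex_eq_iff)
  have cos2: "cos (2 * \<delta>) = \<bar>sin (\<phi> / 2)\<bar>"
  proof (cases "sin (\<phi> / 2) \<ge> 0")
    case True
    then have "2 * \<delta> = pi / 2 - \<phi> / 2"
      by (simp add: \<delta>_def field_simps)
    then show ?thesis
      using True by (simp add: cos_diff)
  next
    case False
    then have "2 * \<delta> = - (pi / 2 + \<phi> / 2)"
      by (simp add: \<delta>_def field_simps)
    then have "cos (2 * \<delta>) = cos (pi / 2 + \<phi> / 2)"
      by (simp only: cos_minus)
    then show ?thesis
      using False by (simp add: cos_add)
  qed
  have cos\<delta>: "\<bar>cos \<delta>\<bar> = sqrt ((1 + \<bar>sin (\<phi> / 2)\<bar>) / 2)"
    using cos_double_cos[of \<delta>] cos2 by (intro real_sqrt_unique[symmetric]) auto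
  have \<sigma>: "cmod \<sigma> = 1" "Re \<sigma> * cos \<delta> = \<bar>cos \<delta>\<bar>" "Im \<sigma> = 0"
    by (auto simp: \<sigma>_def)
  show thesis
  proof
    show "cmod (e j) = 1" for j
      by (simp add: e_def norm_mult \<sigma>)
    have "cis (- (\<theta>$2 - \<delta>)) * cis (- (\<theta>$3 - \<delta>))
        = cis (- (\<theta>$1 + \<delta>)) * cis (- (\<theta>$4 + \<delta>)) * cis (\<phi> + 4 * \<delta> + 2 * pi * of_int m)"
      unfolding cis_mult using \<phi> by (intro arg_cong[of _ _ cis]) (simp add: algebra_simps)
    also have "cis (\<phi> + 4 * \<delta> + 2 * pi * of_int m) = -1"
      by (simp add: cis_\<delta> cis_multiple_2pi flip: cis_mult[of "\<phi> + 4 * \<delta>"])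
    finally have "\<sigma>\<^sup>2 * (cis (- (\<theta>$1 + \<delta>)) * cis (- (\<theta>$4 + \<delta>)))
        = - (\<sigma>\<^sup>2 * (cis (- (\<theta>$2 - \<delta>)) * cis (- (\<theta>$3 - \<delta>))))"
      by simp
    then show "e 1 * e 4 = - (e 2 * e 3)"
      unfolding e_def by (simp add: power2_eq_square mult_ac)
    show "Re (e j * c $ j) = cmod (c $ j) * sqrt ((1 + \<bar>sin (\<phi> / 2)\<bar>) / 2)" for j
    proof -
      have "e j * c $ j
          = \<sigma> * of_real (cmod (c $ j)) * cis (- (if j = 1 \<or> j = 4 then \<delta> else - \<delta>))"
        by (subst c) (simp add: e_def rcis_def cis_mult mult_ac)
      then show ?thesis
        using \<sigma>(2,3) cos\<delta> by (auto simp: mult_ac)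
    qed
  qed
qed

text \<open>The phases \<open>e j\<close> depend on \<open>c\<close> and \<phi> alone, so one linear
  functional tests all terms of the decomposition, and the estimate for single product vectors adds
  up.\<close>

lemma sum_coherence_ge:
  fixes l :: "nat \<Rightarrow> real" and x y w :: "nat \<Rightarrow> qubit" and s :: "4 \<Rightarrow> real"
  defines "z \<equiv> \<lambda>k. product_vec (x k) (y k) (w k)"
  assumes l: "\<And>k. 0 \<le> l k"
    and c: "\<And>j. c $ j =
      (\<Sum>k<n. complex_of_real (l k) * (z k $ upper j * cnj (z k $ lower j)))"
    and phase: "phase_difference c \<phi>"
    and s: "s 1 = s 4 \<and> s 2 = s 3 \<or> s 1 = s 2 \<and> s 3 = s 4 \<or> s 1 = s 3 \<and> s 2 = s 4"
    and nonneg: "\<And>j. 0 \<le> s j"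
  shows "(\<Sum>j\<in>UNIV. s j * cmod (c $ j)) * sqrt ((1 + \<bar>sin (\<phi> / 2)\<bar>) / 2)
    \<le> (\<Sum>k<n. l k * coherence (x k) (y k) (w k)) * sqrt (2 * (\<Sum>j\<in>UNIV. (s j)\<^sup>2))"
proof -
  obtain e where e: "\<And>j. cmod (e j) = 1" "e 1 * e 4 = - (e 2 * e 3)"
    and Re_e: "\<And>j. Re (e j * c $ j) = cmod (c $ j) * sqrt ((1 + \<bar>sin (\<phi> / 2)\<bar>) / 2)"
    using phase_difference_antiphase[OF phase] by blast
  define v where "v k j = e j * (z k $ upper j * cnj (z k $ lower j))" for k j
  have pairing: "Re (e j * c $ j) = (\<Sum>k<n. l k * Re (v k j))" for j
  proof -
    have "e j * c $ j = (\<Sum>k<n. of_real (l k) * v k j)"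
      unfolding c v_def sum_distrib_left by (simp add: mult_ac)
    then show ?thesis
      by simp
  qed
  have "(\<Sum>j\<in>UNIV. s j * cmod (c $ j)) * sqrt ((1 + \<bar>sin (\<phi> / 2)\<bar>) / 2)
      = (\<Sum>j\<in>UNIV. s j * Re (e j * c $ j))"
    by (simp only: Re_e sum_distrib_right mult.assoc)
  also have "\<dots> = (\<Sum>j\<in>UNIV. \<Sum>k<n. l k * (s j * Re (v k j)))"
    by (simp only: pairing sum_distrib_left mult.left_commute)
  also have "\<dots> = (\<Sum>k<n. l k * (\<Sum>j\<in>UNIV. s j * Re (v k j)))"
    by (subst sum.swap) (simp only: sum_distrib_left)
  also have "\<dots> \<le> (\<Sum>k<n. l k * (coherence (x k) (y k) (w k) * sqrt (2 * (\<Sum>j\<in>UNIV. (s j)\<^sup>2))))"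
  proof (intro sum_mono mult_left_mono l Re_weighted_sum_le[OF _ _ s nonneg])
    fix k
    show "cmod (v k j) = coherence (x k) (y k) (w k)" for j
      using norm_product_vec_upper_lower by (simp add: v_def z_def norm_mult[of "e j"] e)
    let ?d = "\<lambda>j. z k $ upper j * cnj (z k $ lower j)"
    have "v k 1 * v k 4 = (e 1 * e 4) * (?d 1 * ?d 4)"
      by (simp add: v_def mult_ac)
    also have "\<dots> = - (e 2 * e 3) * (?d 2 * ?d 3)"
      using product_vec_phase_identity[of "x k" "y k" "w k"] by (simp only: e z_def)
    also have "\<dots> = - (v k 2 * v k 3)"
      by (simp add: v_def mult_ac)
    finally show "v k 1 * v k 4 = - (v k 2 * v k 3)" .
  qed
  finally show ?thesis
    by (simp only: sum_distrib_right mult.assoc)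
qed

section \<open>Weights from the partition and the final bound\<close>

theorem proposition5p2:
  fixes \<rho> :: three_qubit_mat
    and a b :: "real ^ 4" and c :: "complex ^ 4"
    and i1 i2 i3 i4 :: 4
    and m1 m2 \<phi> :: real
  assumes "three_qubit_state \<rho>"
    and "X_part \<rho> = X_mat a b c"
    and "{i1, i2} \<union> {i3, i4} = {1, 2, 3, 4}"
    and "m1 = (cmod (c $ i1) + cmod (c $ i2)) / 2"
    and "m2 = (cmod (c $ i3) + cmod (c $ i4)) / 2"
    and "(m1, m2) \<noteq> (0, 0)"
    and "phase_difference c \<phi>"
    and "separable \<rho>"
  shows "Delta a b \<ge> sqrt 2 * m1 * m2 / sqrt (m1\<^sup>2 + m2\<^sup>2) * sqrt (1 + \<bar>sin (\<phi> / 2)\<bar>)"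
proof -
  obtain n :: nat and l x y w where "\<forall>k. 0 \<le> l k" and "\<forall>i j. \<rho> $ i $ j =
      (\<Sum>k<n. complex_of_real (l k) *
        (product_vec (x k) (y k) (w k) $ i * cnj (product_vec (x k) (y k) (w k) $ j)))"
    using separable_entries[OF assms(8)] by blast
  note l = this(1)[rule_format] and \<rho> = this(2)[rule_format]
  let ?R = "\<Sum>k<n. l k * coherence (x k) (y k) (w k)"
  have diag: "r = (\<Sum>k<n. l k * (cmod (product_vec (x k) (y k) (w k) $ i))\<^sup>2)"
    if "complex_of_real r = \<rho> $ i $ i" for r i
    using that unfolding \<rho> complex_norm_square[symmetric] of_real_mult[symmetric] of_real_sum[symmetric]
    by (simp only: of_real_eq_iff)
  have R_le: "?R \<le> Delta a b"
    by (intro Delta_ge_sum_coherence l diag X_part_eq_X_matD(1,2)[OF assms(2)])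
  have "{i1, i2, i3, i4} = {i1, i2} \<union> {i3, i4}"
    by blast
  then have UNIV_eq: "(UNIV :: 4 set) = {i1, i2, i3, i4}"
    by (simp only: assms(3) UNIV_4)
  \<comment> \<open>The two pairs are disjoint because four indices cover a type with four
    elements.\<close>
  have dist: "distinct [i1, i2, i3, i4]"
  proof (rule card_distinct)
    have "card (set [i1, i2, i3, i4]) = CARD(4)"
      by (simp only: UNIV_eq list.set)
    then show "card (set [i1, i2, i3, i4]) = length [i1, i2, i3, i4]"
      by simp
  qed
  \<comment> \<open>Each index gets the mean modulus of its block; this makes the two sums in the
    pairing bound both equal to \<open>2 * N\<close>.\<close>
  define s where "s j = (if j = i1 \<or> j = i2 then m1 else m2)" for j
  define N where "N = m1\<^sup>2 + m2\<^sup>2"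
  have m_nonneg: "0 \<le> m1" "0 \<le> m2"
    by (simp_all add: assms(4,5))
  have N: "0 < N"
    using assms(6) by (auto simp: N_def sum_power2_gt_zero_iff)
  have sum_sq: "(\<Sum>j\<in>UNIV. (s j)\<^sup>2) = 2 * N"
    unfolding UNIV_eq using dist by (auto simp: s_def N_def)
  have sum_c: "(\<Sum>j\<in>UNIV. s j * cmod (c $ j)) = 2 * N"
  proof -
    have "(\<Sum>j\<in>UNIV. s j * cmod (c $ j))
        = m1 * (cmod (c $ i1) + cmod (c $ i2)) + m2 * (cmod (c $ i3) + cmod (c $ i4))"
      unfolding UNIV_eq using dist by (auto simp: s_def algebra_simps)
    also have "\<dots> = m1 * (2 * m1) + m2 * (2 * m2)"
      by (simp add: assms(4,5) field_simps)
    finally show ?thesis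
      by (simp add: N_def power2_eq_square)
  qed
  \<comment> \<open>The three alternatives for \<open>s\<close> are the three ways to split four
    indices into two pairs.\<close>
  have "i1 \<noteq> i2"
    using dist by simp
  with exhaust_4[of i1] exhaust_4[of i2]
  have "s 1 = s 4 \<and> s 2 = s 3 \<or> s 1 = s 2 \<and> s 3 = s 4 \<or> s 1 = s 3 \<and> s 2 = s 4"
    by (elim disjE) (simp_all add: s_def)
  then have "2 * N * sqrt ((1 + \<bar>sin (\<phi> / 2)\<bar>) / 2) \<le> ?R * sqrt (2 * (2 * N))"
    using sum_coherence_ge[OF l X_part_eq_X_matD(3)[OF assms(2), unfolded \<rho>] assms(7), of s]
      m_nonneg unfolding sum_sq sum_c by (simp add: s_def)
  moreover have "sqrt (2 * (2 * N)) = 2 * sqrt N"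
    by (simp add: real_sqrt_mult)
  ultimately have "N * sqrt ((1 + \<bar>sin (\<phi> / 2)\<bar>) / 2) \<le> sqrt N * ?R"
    by (simp add: mult.commute[of ?R])
  moreover have "sqrt N * (sqrt N * q) = N * q" for q
    using N by (simp flip: mult.assoc)
  ultimately have "sqrt N * (sqrt N * sqrt ((1 + \<bar>sin (\<phi> / 2)\<bar>) / 2)) \<le> sqrt N * ?R"
    by (simp only:)
  then have main: "sqrt N * sqrt ((1 + \<bar>sin (\<phi> / 2)\<bar>) / 2) \<le> ?R"
    using N by (simp only: mult_le_cancel_left_pos real_sqrt_gt_0_iff)
  have "2 * m1 * m2 \<le> N"
    using sum_squares_bound[of m1 m2] by (simp add: N_def)
  moreover have "sqrt 2 * m1 * m2 * sqrt 2 = 2 * m1 * m2"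
    by simp
  ultimately have "sqrt 2 * m1 * m2 * sqrt 2 \<le> N"
    by (simp only:)
  then have "sqrt 2 * m1 * m2 / sqrt N \<le> sqrt N / sqrt 2"
    using N by (simp add: divide_simps)
  then have "sqrt 2 * m1 * m2 / sqrt N * sqrt (1 + \<bar>sin (\<phi> / 2)\<bar>)
      \<le> sqrt N / sqrt 2 * sqrt (1 + \<bar>sin (\<phi> / 2)\<bar>)"
    by (rule mult_right_mono) simp
  also have "\<dots> \<le> Delta a b"
    using main R_le by (simp add: real_sqrt_divide)
  finally show ?thesis
    by (simp add: N_def)
qed

end
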